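(* Let $\mathcal X$ be a normed space over $\mathbb F\in\{\mathbb R,\mathbb C\}$ and let $T\in\mathcal L[\mathcal X]$. Then the following assertions are equivalent. (i) The power sequence $\{T^n\}$ converges weakly. (ii) $T^n\xrightarrow{w}P$ for some $P\in\mathcal L[\mathcal X]$. In this case, and if $T$ is bounded (that is, if $T^n\xrightarrow{w}P$ with $P\in\mathcal L[\mathcal X]$ and $T\in\mathcal B[\mathcal X]$), then (a) $P$ is a projection with $\mathcal R(P)=\mathcal N(I-T)$, and (b) $T^nP=PT^k$ for all nonnegative integers $n,k$; in other words, $TP=T^nP=P=P^2=PT^k=PT$ for all integers $n,k\ge2$. Furthermore, still under the assumption that $T\in\mathcal B[\mathcal X]$ on a normed space $\mathcal X$, (c) $T^n\xrightarrow{w}O$ if and only if $T^n\xrightarrow{w}P$ for some $P\in\mathcal L[\mathcal X]$ and $\mathcal N(I-T)=\{0\}$. Equivalently, $T$ is weakly stable if and only if $\{T^n\}$ converges weakly and $1$ is not an eigenvalue of $T$.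
   Context: For a normed space $\mathcal X$ over $\mathbb F$ ($=\mathbb R$ or $\mathbb C$), $\mathcal L[\mathcal X]$ is the algebra of all linear (not necessarily bounded) transformations of $\mathcal X$ into itself, $\mathcal B[\mathcal X]$ is the normed algebra of all bounded linear transformations of $\mathcal X$ into itself, and $\mathcal X^*=\mathcal B[\mathcal X,\mathbb F]$ is the dual of $\mathcal X$. $\mathcal N(\cdot)$ and $\mathcal R(\cdot)$ denote kernel and range, $I$ is the identity, $O$ the null operator. A projection is an idempotent linear transformation (not assumed bounded). An $\mathcal X$-valued sequence $\{x_n\}$ converges weakly to $z\in\mathcal X$, written $x_n\xrightarrow{w}z$, if $f(x_n)\to f(z)$ for every $f\in\mathcal X^*$; it converges weakly if such a $z\in\mathcal X$ exists. An $\mathcal L[\mathcal X]$-valued sequence $\{T_n\}$ converges weakly if for each $x\in\mathcal X$ the sequence $\{T_nx\}$ converges weakly (to some $z_x\in\mathcal X$). For $T\in\mathcal L[\mathcal X]$, $T_n\xrightarrow{w}T$ means $T_nx\xrightarrow{w}Tx$ for every $x\in\mathcal X$. A transformation $T\in\mathcal L[\mathcal X]$ is weakly stable if $T^n\xrightarrow{w}O$. *)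

theory Defs
  imports "HOL-Analysis.Analysis"
begin

definition (in real_normed_field) normed_field_iso :: "('a \<Rightarrow> 'b::real_normed_field) \<Rightarrow> bool"
  where "normed_field_iso \<phi> \<longleftrightarrow>
    bij \<phi> \<and> (\<forall>x y. \<phi> (x + y) = \<phi> x + \<phi> y) \<and> (\<forall>x y. \<phi> (x * y) = \<phi> x * \<phi> y) \<and>
    (\<forall>r x. \<phi> (r *\<^sub>R x) = r *\<^sub>R \<phi> x) \<and> (\<forall>x. norm (\<phi> x) = norm x)"

(* The scalar field is a type variable, so "F is R or C" is the requirement that the type be a
   copy of real or of complex, with the same algebraic structure and the same modulus. *)
class real_or_complex = real_normed_field +
  assumes real_or_complex:
    "(\<exists>\<phi>::'a \<Rightarrow> real. normed_field_iso \<phi>) \<or> (\<exists>\<phi>::'a \<Rightarrow> complex. normed_field_iso \<phi>)"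

instance real :: real_or_complex
proof
  have "normed_field_iso (id :: real \<Rightarrow> real)"
    by (simp add: normed_field_iso_def)
  then show "(\<exists>\<phi>::real \<Rightarrow> real. normed_field_iso \<phi>) \<or> (\<exists>\<phi>::real \<Rightarrow> complex. normed_field_iso \<phi>)"
    by blast
qed

instance complex :: real_or_complex
proof
  have "normed_field_iso (id :: complex \<Rightarrow> complex)"
    by (simp add: normed_field_iso_def)
  then show "(\<exists>\<phi>::complex \<Rightarrow> real. normed_field_iso \<phi>) \<or> (\<exists>\<phi>::complex \<Rightarrow> complex. normed_field_iso \<phi>)"
    by blast
qed

(* A normed space over F: the type supplies the group and the norm, and smul is the action of F.
   Every normed space over F is a real normed space by restriction of scalars; scale_of_real says
   that the real structure carried by the type is that restriction. *)
locale normed_space_over = vector_space smul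
  for smul :: "'k::real_or_complex \<Rightarrow> 'v::real_normed_vector \<Rightarrow> 'v" +
  assumes norm_scale: "norm (smul c x) = norm c * norm x"
    and scale_of_real: "smul (of_real r) x = r *\<^sub>R x"

lemma normed_space_over_real:
  "normed_space_over ((*\<^sub>R) :: real \<Rightarrow> 'v::real_normed_vector \<Rightarrow> 'v)"
  by unfold_locales (auto simp: algebra_simps)

lemma normed_space_over_self:
  "normed_space_over ((*) :: 'k::real_or_complex \<Rightarrow> 'k \<Rightarrow> 'k)"
  by unfold_locales (auto simp: algebra_simps norm_mult scaleR_conv_of_real)

definition linear_ops :: "('k::real_or_complex \<Rightarrow> 'v::real_normed_vector \<Rightarrow> 'v) \<Rightarrow> ('v \<Rightarrow> 'v) set"
  where "linear_ops smul = {T. Vector_Spaces.linear smul smul T}"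

definition bounded_maps ::
    "('k::real_or_complex \<Rightarrow> 'v::real_normed_vector \<Rightarrow> 'v) \<Rightarrow>
     ('k \<Rightarrow> 'w::real_normed_vector \<Rightarrow> 'w) \<Rightarrow> ('v \<Rightarrow> 'w) set"
  where "bounded_maps s1 s2 =
    {f. Vector_Spaces.linear s1 s2 f \<and> (\<exists>K. \<forall>x. norm (f x) \<le> K * norm x)}"

definition bounded_ops :: "('k::real_or_complex \<Rightarrow> 'v::real_normed_vector \<Rightarrow> 'v) \<Rightarrow> ('v \<Rightarrow> 'v) set"
  where "bounded_ops smul = bounded_maps smul smul"

definition dual_space :: "('k::real_or_complex \<Rightarrow> 'v::real_normed_vector \<Rightarrow> 'v) \<Rightarrow> ('v \<Rightarrow> 'k) set"
  where "dual_space smul = bounded_maps smul (*)"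

definition weakly_tendsto ::
    "('k::real_or_complex \<Rightarrow> 'v::real_normed_vector \<Rightarrow> 'v) \<Rightarrow> (nat \<Rightarrow> 'v) \<Rightarrow> 'v \<Rightarrow> bool"
  where "weakly_tendsto smul X z \<longleftrightarrow> (\<forall>f\<in>dual_space smul. (\<lambda>n. f (X n)) \<longlonglongrightarrow> f z)"

definition weakly_convergent ::
    "('k::real_or_complex \<Rightarrow> 'v::real_normed_vector \<Rightarrow> 'v) \<Rightarrow> (nat \<Rightarrow> 'v) \<Rightarrow> bool"
  where "weakly_convergent smul X \<longleftrightarrow> (\<exists>z. weakly_tendsto smul X z)"

(* The limits of the sequences S n x may depend on x in an arbitrary way. *)
definition ops_weakly_convergent ::
    "('k::real_or_complex \<Rightarrow> 'v::real_normed_vector \<Rightarrow> 'v) \<Rightarrow> (nat \<Rightarrow> 'v \<Rightarrow> 'v) \<Rightarrow> bool"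
  where "ops_weakly_convergent smul S \<longleftrightarrow> (\<forall>x. weakly_convergent smul (\<lambda>n. S n x))"

definition ops_weakly_tendsto ::
    "('k::real_or_complex \<Rightarrow> 'v::real_normed_vector \<Rightarrow> 'v) \<Rightarrow> (nat \<Rightarrow> 'v \<Rightarrow> 'v) \<Rightarrow> ('v \<Rightarrow> 'v) \<Rightarrow> bool"
  where "ops_weakly_tendsto smul S P \<longleftrightarrow> (\<forall>x. weakly_tendsto smul (\<lambda>n. S n x) (P x))"

definition weakly_stable ::
    "('k::real_or_complex \<Rightarrow> 'v::real_normed_vector \<Rightarrow> 'v) \<Rightarrow> ('v \<Rightarrow> 'v) \<Rightarrow> bool"
  where "weakly_stable smul T \<longleftrightarrow> ops_weakly_tendsto smul (\<lambda>n. T ^^ n) (\<lambda>x. 0)"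

definition is_projection ::
    "('k::real_or_complex \<Rightarrow> 'v::real_normed_vector \<Rightarrow> 'v) \<Rightarrow> ('v \<Rightarrow> 'v) \<Rightarrow> bool"
  where "is_projection smul P \<longleftrightarrow> P \<in> linear_ops smul \<and> P \<circ> P = P"

definition null_space :: "('v::real_normed_vector \<Rightarrow> 'v) \<Rightarrow> 'v set"
  where "null_space A = {x. A x = 0}"

definition is_eigenvalue ::
    "('k::real_or_complex \<Rightarrow> 'v::real_normed_vector \<Rightarrow> 'v) \<Rightarrow> ('v \<Rightarrow> 'v) \<Rightarrow> 'k \<Rightarrow> bool"
  where "is_eigenvalue smul T c \<longleftrightarrow> (\<exists>x. x \<noteq> 0 \<and> T x = smul c x)"

end

theory Submission
  imports Defs
begin

text \<open>
  Everything rests on the dual separating points, which is the Hahn--Banach theorem. Its real form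
  comes from Zorn's lemma applied to sublinear functionals below the norm: if \<open>q\<close> is sublinear, so is
  \<open>x \<mapsto> inf\<^sub>t\<^sub>\<ge>\<^sub>0 (q (x + t z) - t q z)\<close>, which lies below \<open>q\<close>; hence a minimal \<open>q\<close> equals it for
  every \<open>z\<close>, and that makes \<open>q\<close> additive. Weak limits are therefore unique, so that the pointwise weak
  limit \<open>P\<close> of \<open>T\<^sup>n\<close> is linear. Comparing the limits of \<open>T\<^sup>n\<close> and \<open>T\<^sup>n\<^sup>+\<^sup>1\<close> gives \<open>P T = P\<close>, and \<open>T P = P\<close>
  because \<open>f \<circ> T\<close> is again a bounded functional when \<open>T\<close> is bounded; the rest is algebra.
\<close>

section \<open>Real functionals dominated by the norm\<close>

definition sublinear :: "('v::real_vector \<Rightarrow> real) \<Rightarrow> bool"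
  where "sublinear q \<longleftrightarrow>
    (\<forall>x y. q (x + y) \<le> q x + q y) \<and> (\<forall>t x. t > 0 \<longrightarrow> q (t *\<^sub>R x) = t * q x)"

text \<open>The reverse inequality in the homogeneity comes from applying the given one with factor
  \<open>1/t\<close> to \<open>t *\<^sub>R x\<close>.\<close>

lemma sublinearI:
  assumes "\<And>x y. q (x + y) \<le> q x + q y"
    and "\<And>t x. t > 0 \<Longrightarrow> q (t *\<^sub>R x) \<le> t * q x"
  shows "sublinear q"
  unfolding sublinear_def
proof (intro conjI allI impI)
  fix t :: real and x assume t: "t > 0"
  have "q ((1/t) *\<^sub>R (t *\<^sub>R x)) \<le> (1/t) * q (t *\<^sub>R x)"
    using t by (intro assms(2)) simp
  then have "t * q x \<le> q (t *\<^sub>R x)"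
    using t by (simp add: field_simps)
  then show "q (t *\<^sub>R x) = t * q x"
    using assms(2)[OF t, of x] by simp
qed (fact assms(1))

lemma sublinear_add: "sublinear q \<Longrightarrow> q (x + y) \<le> q x + q y"
  by (simp add: sublinear_def)

lemma sublinear_scaleR: "sublinear q \<Longrightarrow> t > 0 \<Longrightarrow> q (t *\<^sub>R x) = t * q x"
  by (simp add: sublinear_def)

lemma sublinear_zero: "sublinear q \<Longrightarrow> q 0 = 0"
  using sublinear_scaleR[of q 2 0] by simp

lemma sublinear_norm: "sublinear (norm :: 'v::real_normed_vector \<Rightarrow> real)"
  by (simp add: sublinear_def norm_triangle_ineq)

lemma sublinear_minus: "sublinear q \<Longrightarrow> - q (- x) \<le> q x"
  using sublinear_add[of q x "- x"] sublinear_zero[of q] by simp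

text \<open>For sublinear \<open>q\<close> this is the largest sublinear functional below
  \<open>q\<close> whose value at \<open>- z\<close> is at most \<open>- q z\<close>.\<close>

definition tilt :: "('v::real_vector \<Rightarrow> real) \<Rightarrow> 'v \<Rightarrow> 'v \<Rightarrow> real"
  where "tilt q z x = (INF t\<in>{0..}. q (x + t *\<^sub>R z) - t * q z)"

text \<open>Subadditivity is applied to the sum of \<open>x + t *\<^sub>R z\<close> and
  \<open>- x\<close>. The bound does not depend on \<open>t\<close>, so \<open>tilt\<close> is the
  infimum of a set bounded below.\<close>

lemma tilt_lower:
  assumes "sublinear q" "t \<ge> 0"
  shows "- q (- x) \<le> q (x + t *\<^sub>R z) - t * q z"
proof (cases "t = 0")
  case True
  then show ?thesis using sublinear_minus[OF assms(1)] by simp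
next
  case False
  then have "t * q z = q ((x + t *\<^sub>R z) + - x)"
    using assms by (simp add: sublinear_scaleR)
  also have "\<dots> \<le> q (x + t *\<^sub>R z) + q (- x)"
    by (rule sublinear_add[OF assms(1)])
  finally show ?thesis by simp
qed

lemma tilt_le:
  assumes "sublinear q" "t \<ge> 0"
  shows "tilt q z x \<le> q (x + t *\<^sub>R z) - t * q z"
  unfolding tilt_def using assms
  by (intro cINF_lower bdd_belowI2[where m = "- q (- x)"]) (auto intro: tilt_lower)

lemma tilt_ge:
  assumes "\<And>t. t \<ge> 0 \<Longrightarrow> m \<le> q (x + t *\<^sub>R z) - t * q z"
  shows "m \<le> tilt q z x"
  unfolding tilt_def by (rule cINF_greatest) (use assms in auto)

lemma tilt_le_self: "sublinear q \<Longrightarrow> tilt q z x \<le> q x"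
  using tilt_le[of q 0 z x] by simp

lemma tilt_minus: "sublinear q \<Longrightarrow> tilt q z (- z) \<le> - q z"
  using tilt_le[of q 1 z "- z"] by (simp add: sublinear_zero)

text \<open>Parameters \<open>s\<close> for \<open>x\<close> and \<open>t\<close> for
  \<open>y\<close> combine to \<open>s + t\<close> for \<open>x + y\<close>; when \<open>x\<close>
  is scaled by \<open>t\<close>, the parameter \<open>s\<close> becomes
  \<open>t * s\<close>.\<close>

lemma sublinear_tilt:
  assumes q: "sublinear q"
  shows "sublinear (tilt q z)"
proof (rule sublinearI)
  fix x y
  \<comment> \<open>The term in \<open>y\<close> stands on the left so that the infima over
    \<open>s\<close> and over \<open>t\<close> can be taken one after the other.\<close>
  have "tilt q z (x + y) - (q (y + t *\<^sub>R z) - t * q z) \<le> q (x + s *\<^sub>R z) - s * q z"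
    if "s \<ge> 0" "t \<ge> 0" for s t
  proof -
    have "tilt q z (x + y) \<le> q ((x + y) + (s + t) *\<^sub>R z) - (s + t) * q z"
      using that by (intro tilt_le[OF q]) simp
    also have "(x + y) + (s + t) *\<^sub>R z = (x + s *\<^sub>R z) + (y + t *\<^sub>R z)"
      by (simp add: algebra_simps)
    also have "q \<dots> \<le> q (x + s *\<^sub>R z) + q (y + t *\<^sub>R z)"
      by (rule sublinear_add[OF q])
    finally show ?thesis by (simp add: algebra_simps)
  qed
  then have "tilt q z (x + y) - (q (y + t *\<^sub>R z) - t * q z) \<le> tilt q z x" if "t \<ge> 0" for t
    using that by (intro tilt_ge) auto
  then have "tilt q z (x + y) - tilt q z x \<le> tilt q z y"
    by (intro tilt_ge) (simp add: algebra_simps)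
  then show "tilt q z (x + y) \<le> tilt q z x + tilt q z y" by simp
next
  fix t :: real and x assume t: "t > 0"
  have "tilt q z (t *\<^sub>R x) / t \<le> tilt q z x"
  proof (rule tilt_ge)
    fix s :: real assume s: "s \<ge> 0"
    have "tilt q z (t *\<^sub>R x) \<le> q (t *\<^sub>R x + (t * s) *\<^sub>R z) - (t * s) * q z"
      using s t by (intro tilt_le[OF q]) simp
    also have "t *\<^sub>R x + (t * s) *\<^sub>R z = t *\<^sub>R (x + s *\<^sub>R z)"
      by (simp add: algebra_simps)
    also have "q \<dots> = t * q (x + s *\<^sub>R z)"
      by (rule sublinear_scaleR[OF q t])
    finally show "tilt q z (t *\<^sub>R x) / t \<le> q (x + s *\<^sub>R z) - s * q z"
      using t by (simp add: field_simps)
  qed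
  then show "tilt q z (t *\<^sub>R x) \<le> t * tilt q z x"
    using t by (simp add: field_simps)
qed

text \<open>Zorn's lemma for the reversed pointwise order: the infimum of a nonempty chain is again
  sublinear and bounds the chain from below.\<close>

lemma minimal_sublinear_exists:
  assumes p: "sublinear p"
  obtains q where "sublinear q" "q \<le> p" "\<And>r. sublinear r \<Longrightarrow> r \<le> q \<Longrightarrow> r = q"
proof -
  let ?A = "{q. sublinear q \<and> q \<le> p}"
  have "\<exists>u\<in>?A. \<forall>q\<in>C. u \<le> q" if C: "C \<in> Chains (relation_of (\<lambda>a b. b \<le> a) ?A)" for C
  \<comment> \<open>An infimum over the empty chain says nothing, so there \<open>p\<close> itself
    is the bound.\<close>
  proof (cases "C = {}")
    case True
    then show ?thesis using p by auto
  next
    case False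
    have sub: "sublinear q" "q x \<le> p x" if "q \<in> C" for q x
      using C that by (auto simp: Chains_def relation_of_def le_fun_def)
    have chain: "a \<le> b \<or> b \<le> a" if "a \<in> C" "b \<in> C" for a b
      using C that by (auto simp: Chains_def relation_of_def)
    let ?u = "\<lambda>x. INF q\<in>C. q x"
    \<comment> \<open>A bound common to all members of the chain makes the pointwise infimum a
      genuine one.\<close>
    have "- p (- x) \<le> q x" if "q \<in> C" for q x
      using sublinear_minus[OF sub(1)[OF that], of x] sub(2)[OF that, of "- x"] by simp
    then have lower: "?u x \<le> q x" if "q \<in> C" for q x
      using that by (intro cINF_lower bdd_belowI2[where m = "- p (- x)"]) auto
    have greatest: "m \<le> ?u x" if "\<And>q. q \<in> C \<Longrightarrow> m \<le> q x" for m x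
      using False that by (intro cINF_greatest)
    have "sublinear ?u"
    proof (rule sublinearI)
      fix x y
      have "?u (x + y) - b y \<le> a x" if ab: "a \<in> C" "b \<in> C" for a b
      proof -
        \<comment> \<open>Subadditivity concerns a single functional; the smaller of
          \<open>a\<close> and \<open>b\<close> serves for both.\<close>
        obtain c where c: "c \<in> C" "c \<le> a" "c \<le> b"
          using chain[OF ab] ab by (metis order_refl)
        have "?u (x + y) \<le> c x + c y"
          using lower[OF c(1)] sublinear_add[OF sub(1)[OF c(1)]] by (rule order_trans)
        also have "\<dots> \<le> a x + b y"
          using c by (intro add_mono) (auto simp: le_fun_def)
        finally show ?thesis by simp
      qed
      then have "?u (x + y) - b y \<le> ?u x" if "b \<in> C" for b
        using that by (intro greatest) auto
      then have "?u (x + y) - ?u x \<le> b y" if "b \<in> C" for b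
        using that by (simp add: algebra_simps)
      then have "?u (x + y) - ?u x \<le> ?u y"
        by (rule greatest)
      then show "?u (x + y) \<le> ?u x + ?u y" by simp
    next
      fix t :: real and x assume t: "t > 0"
      have "?u (t *\<^sub>R x) / t \<le> ?u x"
      proof (rule greatest)
        fix q assume "q \<in> C"
        then show "?u (t *\<^sub>R x) / t \<le> q x"
          using lower[of q "t *\<^sub>R x"] sublinear_scaleR[OF sub(1) t, of q x] t
          by (simp add: field_simps)
      qed
      then show "?u (t *\<^sub>R x) \<le> t * ?u x"
        using t by (simp add: field_simps)
    qed
    moreover have "?u \<le> p"
    proof (rule le_funI)
      fix x
      obtain q where "q \<in> C" using False by blast
      then show "?u x \<le> p x"
        using lower[of q x] sub(2)[of q x] by simp
    qed
    moreover have "\<forall>q\<in>C. ?u \<le> q"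
      using lower by (auto simp: le_fun_def)
    ultimately show ?thesis by blast
  qed
  moreover have "partial_order_on ?A (relation_of (\<lambda>a b. b \<le> a) ?A)"
    by (intro partial_order_on_relation_ofI) auto
  ultimately obtain q where "q \<in> ?A" "\<And>r. r \<in> ?A \<Longrightarrow> r \<le> q \<Longrightarrow> r = q"
    using predicate_Zorn[of ?A "\<lambda>a b. b \<le> a"] by blast
  then show ?thesis
    by (intro that[of q]) auto
qed

text \<open>Minimality forces \<open>tilt q z = q\<close>, and the parameter 1 then gives the
  reverse of subadditivity. Additivity makes \<open>q\<close> odd, which settles negative
  scalars.\<close>

lemma minimal_sublinear_linear:
  assumes q: "sublinear q" and min: "\<And>r. sublinear r \<Longrightarrow> r \<le> q \<Longrightarrow> r = q"
  shows "linear q"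
proof -
  have tilt: "tilt q z = q" for z
    by (intro min sublinear_tilt q) (simp add: le_fun_def tilt_le_self[OF q])
  have add: "q (x + z) = q x + q z" for x z
    using tilt_le[OF q, of 1 z x] sublinear_add[OF q, of x z] by (simp add: tilt)
  have minus: "q (- x) = - q x" for x
    using add[of x "- x"] sublinear_zero[OF q] by simp
  show ?thesis
  proof (rule linearI)
    fix t :: real and x
    consider "t > 0" | "t = 0" | "t < 0" by linarith
    then show "q (t *\<^sub>R x) = t *\<^sub>R q x"
    proof cases
      case 3
      then show ?thesis
        using sublinear_scaleR[OF q, of "- t" x] minus[of "t *\<^sub>R x"] by simp
    qed (simp_all add: q sublinear_scaleR sublinear_zero)
  qed (fact add)
qed

text \<open>The minimal functional is sought below \<open>tilt norm z\<close> instead of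
  \<open>norm\<close>: there the value at \<open>- z\<close> is at most \<open>- norm z\<close>, so
  linearity forces the value at \<open>z\<close> up to \<open>norm z\<close>.\<close>

lemma real_functional_norming:
  fixes z :: "'v::real_normed_vector"
  obtains f :: "'v \<Rightarrow> real" where "linear f" "\<And>x. \<bar>f x\<bar> \<le> norm x" "f z = norm z"
proof -
  obtain q where q: "sublinear q" "q \<le> tilt norm z" "\<And>r. sublinear r \<Longrightarrow> r \<le> q \<Longrightarrow> r = q"
    using minimal_sublinear_exists[OF sublinear_tilt[OF sublinear_norm, of z]] by blast
  then have lin: "linear q"
    by (intro minimal_sublinear_linear)
  have le: "q x \<le> norm x" for x
    using q(2) tilt_le_self[OF sublinear_norm] by (auto simp: le_fun_def intro: order_trans)
  have abs: "\<bar>q x\<bar> \<le> norm x" for x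
    using le[of x] le[of "- x"] by (simp add: linear_neg[OF lin] abs_le_iff)
  have "q (- z) \<le> - norm z"
    using q(2) tilt_minus[OF sublinear_norm, of z] by (auto simp: le_fun_def intro: order_trans)
  then have "q z = norm z"
    using le[of z] by (simp add: linear_neg[OF lin])
  with lin abs show ?thesis by (rule that)
qed

section \<open>The dual separates points\<close>

lemma normed_field_iso_of_real:
  assumes "normed_field_iso (\<phi> :: 'a::real_normed_field \<Rightarrow> 'b::real_normed_field)"
  shows "\<phi> (of_real r) = of_real r"
proof -
  have "\<phi> 1 * \<phi> 1 = \<phi> 1" "norm (\<phi> 1) = 1"
    using assms unfolding normed_field_iso_def by (metis mult_1, metis norm_one)
  \<comment> \<open>An idempotent of a field is 0 or 1, and norm 1 excludes 0.\<close>
  then have "\<phi> 1 = 1" by auto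
  moreover have "\<phi> (r *\<^sub>R 1) = r *\<^sub>R \<phi> 1"
    using assms by (auto simp: normed_field_iso_def)
  ultimately show ?thesis by (simp add: of_real_def)
qed

text \<open>Pulling back along the isomorphism lets later arguments stay inside \<open>'k\<close>;
  the element \<open>j\<close> is the preimage of the imaginary unit.\<close>

lemma real_or_complex_cases:
  obtains (real) "\<And>c::'k::real_or_complex. \<exists>a. c = of_real a"
  | (complex) j :: "'k::real_or_complex" where "j * j = -1" "norm j = 1" "\<And>c. \<exists>a b. c = of_real a + j * of_real b"
  using real_or_complex[where 'a = 'k]
proof
  assume "\<exists>\<phi>::'k \<Rightarrow> real. normed_field_iso \<phi>"
  then obtain \<phi> :: "'k \<Rightarrow> real" where iso: "normed_field_iso \<phi>" ..
  then have "inj \<phi>" by (auto simp: normed_field_iso_def bij_def)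
  moreover have "\<phi> c = \<phi> (of_real (\<phi> c))" for c
    by (simp add: normed_field_iso_of_real[OF iso])
  ultimately show thesis by (intro real) (metis injD)
next
  assume "\<exists>\<phi>::'k \<Rightarrow> complex. normed_field_iso \<phi>"
  then obtain \<phi> :: "'k \<Rightarrow> complex" where iso: "normed_field_iso \<phi>" ..
  then have inj: "inj \<phi>" and surj: "surj \<phi>"
    and add: "\<And>x y. \<phi> (x + y) = \<phi> x + \<phi> y" and mult: "\<And>x y. \<phi> (x * y) = \<phi> x * \<phi> y"
    and norm: "\<And>x. norm (\<phi> x) = norm x"
    by (auto simp: normed_field_iso_def bij_def)
  obtain j where j: "\<phi> j = \<i>"
    using surj by (metis surjD)
  have "\<phi> (j * j) = \<phi> (of_real (- 1))"
    by (simp only: mult j normed_field_iso_of_real[OF iso]) simp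
  then have "j * j = -1"
    using inj by (auto dest: injD)
  moreover have "norm j = 1"
    using norm[of j] by (simp add: j)
  moreover have "c = of_real (Re (\<phi> c)) + j * of_real (Im (\<phi> c))" for c
  proof -
    have "\<phi> c = \<phi> (of_real (Re (\<phi> c)) + j * of_real (Im (\<phi> c)))"
      by (simp only: add mult j normed_field_iso_of_real[OF iso] complex_eq[symmetric])
    then show ?thesis using inj by (auto dest: injD)
  qed
  ultimately show thesis by (intro complex) blast+
qed

section \<open>Functionals over the scalar field\<close>

context normed_space_over
begin

lemma dual_space_iff:
  "f \<in> dual_space smul \<longleftrightarrow> (\<forall>x y. f (x + y) = f x + f y) \<and> (\<forall>c x. f (smul c x) = c * f x)
    \<and> (\<exists>K. \<forall>x. norm (f x) \<le> K * norm x)"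
proof -
  have "vector_space ((*) :: 'k \<Rightarrow> 'k \<Rightarrow> 'k)"
    by unfold_locales (auto simp: algebra_simps)
  then show ?thesis
    by (simp add: dual_space_def bounded_maps_def Vector_Spaces.linear_iff vector_space_axioms)
qed

lemma linear_ops_iff:
  "A \<in> linear_ops smul \<longleftrightarrow>
    (\<forall>x y. A (x + y) = A x + A y) \<and> (\<forall>c x. A (smul c x) = smul c (A x))"
  by (simp add: linear_ops_def Vector_Spaces.linear_iff vector_space_axioms)

lemma dual_spaceI:
  assumes "\<And>x y. f (x + y) = f x + f y" "\<And>c x. f (smul c x) = c * f x"
    and "\<And>x. norm (f x) \<le> K * norm x"
  shows "f \<in> dual_space smul"
  using assms by (auto simp: dual_space_iff)

lemma dual_space_add: "f \<in> dual_space smul \<Longrightarrow> f (x + y) = f x + f y"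
  by (simp add: dual_space_iff)

lemma dual_space_smul: "f \<in> dual_space smul \<Longrightarrow> f (smul c x) = c * f x"
  by (simp add: dual_space_iff)

lemma dual_space_diff: "f \<in> dual_space smul \<Longrightarrow> f (x - y) = f x - f y"
  using dual_space_add[of f "x - y" y] by simp

lemma dual_space_separates_zero:
  assumes "z \<noteq> 0"
  obtains f where "f \<in> dual_space smul" "f z \<noteq> 0"
proof -
  obtain f :: "'v \<Rightarrow> real" where f: "linear f" "\<And>x. \<bar>f x\<bar> \<le> norm x" "f z = norm z"
    using real_functional_norming[of z] by blast
  note f_lin = linear_add[OF f(1)] linear_scale[OF f(1)] linear_neg[OF f(1)]
  show ?thesis
  proof (cases rule: real_or_complex_cases[where 'k = 'k])
    case real
    let ?g = "\<lambda>x. of_real (f x) :: 'k"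
    have "?g \<in> dual_space smul"
    proof (rule dual_spaceI[where K = 1])
      fix c :: 'k and x
      obtain a where "c = of_real a" using real by blast
      then show "?g (smul c x) = c * ?g x"
        by (simp add: scale_of_real f_lin)
    qed (use f(2) in \<open>simp_all add: f_lin\<close>)
    moreover have "?g z \<noteq> 0" using assms by (simp add: f(3))
    ultimately show ?thesis by (rule that)
  next
    case (complex j)
    have jj: "j * (j * c) = - c" for c
      using complex(1) by (simp flip: mult.assoc)
    \<comment> \<open>The functional over \<open>\<complex>\<close> with real part \<open>f\<close>.\<close>
    let ?g = "\<lambda>x. of_real (f x) - j * of_real (f (smul j x))"
    have add: "?g (x + y) = ?g x + ?g y" for x y
      by (simp add: f_lin scale_right_distrib algebra_simps)
    have real_hom: "?g (smul (of_real r) x) = of_real r * ?g x" for r x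
    proof -
      have "smul j (r *\<^sub>R x) = r *\<^sub>R smul j x"
        by (simp add: mult.commute flip: scale_of_real)
      then show ?thesis
        by (simp add: scale_of_real f_lin algebra_simps)
    qed
    \<comment> \<open>Since \<open>j * j = -1\<close>, passing from \<open>x\<close> to
      \<open>smul j x\<close> swaps the two terms of \<open>?g\<close> up to the factor
      \<open>j\<close>.\<close>
    have j_hom: "?g (smul j x) = j * ?g x" for x
      by (simp add: complex(1) f_lin algebra_simps jj)
    have "?g \<in> dual_space smul"
    \<comment> \<open>The constant 2 is the triangle inequality: \<open>x\<close> and
      \<open>smul j x\<close> have the same norm.\<close>
    proof (rule dual_spaceI[where K = 2])
      fix c x
      obtain a b where "c = of_real a + j * of_real b" using complex(3) by blast
      then have "smul c x = smul (of_real a) x + smul j (smul (of_real b) x)"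
        by (simp add: scale_left_distrib)
      then have "?g (smul c x) = of_real a * ?g x + j * (of_real b * ?g x)"
        by (simp only: add j_hom real_hom)
      then show "?g (smul c x) = c * ?g x"
        using \<open>c = _\<close> by (simp only: distrib_right mult.assoc)
    next
      fix x
      have "norm (?g x) \<le> \<bar>f x\<bar> + \<bar>f (smul j x)\<bar>"
        using norm_triangle_ineq4[of "of_real (f x) :: 'k" "j * of_real (f (smul j x))"]
        by (simp add: norm_mult complex(2))
      then show "norm (?g x) \<le> 2 * norm x"
        using f(2)[of x] f(2)[of "smul j x"] by (simp add: norm_scale complex(2))
    qed (fact add)
    moreover have "?g z \<noteq> 0"
    proof
      assume "?g z = 0"
      then have eq: "of_real (f z) = j * of_real (f (smul j z))" by simp
      \<comment> \<open>Real parts are not at hand in \<open>'k\<close>. Squaring instead equates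
        the square of one real number with minus the square of another, so both vanish.\<close>
      have "of_real (f z * f z) = j * (j * of_real (f (smul j z) * f (smul j z)))"
        unfolding of_real_mult by (subst (1 2) eq) (simp only: ac_simps)
      also have "\<dots> = of_real (- (f (smul j z) * f (smul j z)))"
        by (simp only: jj of_real_minus)
      finally have "f z * f z + f (smul j z) * f (smul j z) = 0"
        unfolding of_real_eq_iff by simp
      then have "f z = 0" by (simp add: sum_squares_eq_zero_iff)
      then show False using assms f(3) by simp
    qed
    ultimately show ?thesis by (rule that)
  qed
qed

lemma dual_space_eqI:
  assumes "\<And>f. f \<in> dual_space smul \<Longrightarrow> f x = f y"
  shows "x = y"
proof (rule ccontr)
  assume "x \<noteq> y"
  then obtain f where "f \<in> dual_space smul" "f (x - y) \<noteq> 0"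
    using dual_space_separates_zero[of "x - y"] by auto
  then show False using assms by (simp add: dual_space_diff)
qed

section \<open>Weak limits\<close>

text \<open>Through this lemma alone the separation of points enters all that follows.\<close>

lemma weakly_tendsto_unique:
  assumes "weakly_tendsto smul X y" "weakly_tendsto smul X z"
  shows "y = z"
  using assms by (intro dual_space_eqI) (auto simp: weakly_tendsto_def intro: LIMSEQ_unique)

lemma weakly_tendsto_const: "weakly_tendsto smul (\<lambda>n. z) z"
  by (simp add: weakly_tendsto_def)

lemma weakly_tendsto_add:
  "weakly_tendsto smul X y \<Longrightarrow> weakly_tendsto smul Y z \<Longrightarrow> weakly_tendsto smul (\<lambda>n. X n + Y n) (y + z)"
  by (auto simp: weakly_tendsto_def dual_space_add intro: tendsto_add)

lemma weakly_tendsto_smul: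
  "weakly_tendsto smul X z \<Longrightarrow> weakly_tendsto smul (\<lambda>n. smul c (X n)) (smul c z)"
  by (auto simp: weakly_tendsto_def dual_space_smul intro: tendsto_mult_left)

lemma weakly_tendsto_Suc: "weakly_tendsto smul X z \<Longrightarrow> weakly_tendsto smul (\<lambda>n. X (Suc n)) z"
  by (auto simp: weakly_tendsto_def intro: LIMSEQ_Suc)

section \<open>Linear and bounded operators under weak limits\<close>

lemma linear_ops_add: "A \<in> linear_ops smul \<Longrightarrow> A (x + y) = A x + A y"
  by (simp add: linear_ops_iff)

lemma linear_ops_smul: "A \<in> linear_ops smul \<Longrightarrow> A (smul c x) = smul c (A x)"
  by (simp add: linear_ops_iff)

lemma linear_ops_funpow:
  assumes "A \<in> linear_ops smul"
  shows "A ^^ n \<in> linear_ops smul"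
  by (induction n) (simp_all add: linear_ops_iff linear_ops_add[OF assms] linear_ops_smul[OF assms])

text \<open>The adjoint of a bounded operator maps the dual into itself, which makes the operator
  weakly sequentially continuous.\<close>

lemma dual_space_comp_bounded_op:
  assumes f: "f \<in> dual_space smul" and T: "T \<in> bounded_ops smul"
  shows "(\<lambda>x. f (T x)) \<in> dual_space smul"
proof -
  have lin: "T \<in> linear_ops smul"
    using T by (simp add: bounded_ops_def bounded_maps_def linear_ops_def)
  obtain K where K: "norm (f x) \<le> K * norm x" for x
    using f by (auto simp: dual_space_def bounded_maps_def)
  obtain L where L: "norm (T x) \<le> L * norm x" for x
    using T by (auto simp: bounded_ops_def bounded_maps_def)
  show ?thesis
  \<comment> \<open>On the zero space \<open>K\<close> could be negative; its absolute value keeps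
    the multiplication of inequalities monotone.\<close>
  proof (rule dual_spaceI[where K = "\<bar>K\<bar> * L"])
    fix x
    have "norm (f (T x)) \<le> \<bar>K\<bar> * norm (T x)"
      using K[of "T x"] by (rule order_trans) (simp add: mult_right_mono)
    also have "\<dots> \<le> \<bar>K\<bar> * (L * norm x)"
      by (intro mult_left_mono L) simp
    finally show "norm (f (T x)) \<le> \<bar>K\<bar> * L * norm x" by (simp add: mult.assoc)
  qed (simp_all add: f lin linear_ops_add linear_ops_smul dual_space_add dual_space_smul)
qed

lemma weakly_tendsto_bounded_op:
  "T \<in> bounded_ops smul \<Longrightarrow> weakly_tendsto smul X z \<Longrightarrow> weakly_tendsto smul (\<lambda>n. T (X n)) (T z)"
  by (auto simp: weakly_tendsto_def dest: dual_space_comp_bounded_op)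

text \<open>Linearity of each \<open>S n\<close> yields two weak limits of one sequence, and
  uniqueness identifies them.\<close>

lemma ops_weakly_tendsto_linear:
  assumes S: "\<And>n. S n \<in> linear_ops smul" and P: "ops_weakly_tendsto smul S P"
  shows "P \<in> linear_ops smul"
  unfolding linear_ops_iff
proof (intro conjI allI)
  have lim: "weakly_tendsto smul (\<lambda>n. S n x) (P x)" for x
    using P by (simp add: ops_weakly_tendsto_def)
  show "P (x + y) = P x + P y" for x y
    using lim[of "x + y"] weakly_tendsto_add[OF lim lim, of x y]
    by (simp add: linear_ops_add[OF S] weakly_tendsto_unique)
  show "P (smul c x) = smul c (P x)" for c x
    using lim[of "smul c x"] weakly_tendsto_smul[OF lim, of c x]
    by (simp add: linear_ops_smul[OF S] weakly_tendsto_unique)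
qed

lemma ops_weakly_convergent_iff:
  assumes "\<And>n. S n \<in> linear_ops smul"
  shows "ops_weakly_convergent smul S \<longleftrightarrow> (\<exists>P\<in>linear_ops smul. ops_weakly_tendsto smul S P)"
proof
  assume "ops_weakly_convergent smul S"
  \<comment> \<open>The axiom of choice collects the limits at the individual points into a
    function.\<close>
  then obtain P where "ops_weakly_tendsto smul S P"
    unfolding ops_weakly_convergent_def weakly_convergent_def ops_weakly_tendsto_def by metis
  then show "\<exists>P\<in>linear_ops smul. ops_weakly_tendsto smul S P"
    using ops_weakly_tendsto_linear[of S, OF assms] by blast
qed (auto simp: ops_weakly_convergent_def weakly_convergent_def ops_weakly_tendsto_def)

section \<open>Weak limits of power sequences\<close>

text \<open>The orbit of \<open>T x\<close> is the orbit of \<open>x\<close> shifted by one index,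
  so both have the same weak limit.\<close>

lemma power_limit_comp:
  assumes "ops_weakly_tendsto smul (\<lambda>n. T ^^ n) P"
  shows "P \<circ> T = P"
proof
  fix x
  have lim: "weakly_tendsto smul (\<lambda>n. (T ^^ n) y) (P y)" for y
    using assms by (simp add: ops_weakly_tendsto_def)
  show "(P \<circ> T) x = P x"
    using lim[of "T x"] weakly_tendsto_Suc[OF lim, of x]
    by (simp add: funpow_swap1 weakly_tendsto_unique)
qed

text \<open>Weak continuity of \<open>T\<close> moves it inside the limit, where it again only
  shifts the orbit.\<close>

lemma comp_power_limit:
  assumes "T \<in> bounded_ops smul" "ops_weakly_tendsto smul (\<lambda>n. T ^^ n) P"
  shows "T \<circ> P = P"
proof
  fix x
  have lim: "weakly_tendsto smul (\<lambda>n. (T ^^ n) x) (P x)"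
    using assms(2) by (simp add: ops_weakly_tendsto_def)
  show "(T \<circ> P) x = P x"
    using weakly_tendsto_bounded_op[OF assms(1) lim] weakly_tendsto_Suc[OF lim]
    by (simp add: weakly_tendsto_unique)
qed

lemma power_limit_fixed:
  assumes "ops_weakly_tendsto smul (\<lambda>n. T ^^ n) P" "T x = x"
  shows "P x = x"
proof -
  have fixed: "(T ^^ n) x = x" for n
    by (induction n) (simp_all add: assms(2))
  have "weakly_tendsto smul (\<lambda>n. (T ^^ n) x) (P x)"
    using assms(1) by (simp add: ops_weakly_tendsto_def)
  then have "weakly_tendsto smul (\<lambda>n. x) (P x)"
    by (simp only: fixed)
  then show ?thesis
    using weakly_tendsto_const weakly_tendsto_unique by blast
qed

text \<open>By \<open>T \<circ> P = P\<close> every value of \<open>P\<close> is fixed by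
  \<open>T\<close>; conversely a vector fixed by \<open>T\<close> has a constant orbit, so
  \<open>P\<close> maps it to itself.\<close>

lemma range_power_limit:
  assumes "T \<in> bounded_ops smul" "ops_weakly_tendsto smul (\<lambda>n. T ^^ n) P"
  shows "range P = null_space (\<lambda>x. x - T x)"
proof (intro equalityI subsetI)
  fix y assume "y \<in> range P"
  then show "y \<in> null_space (\<lambda>x. x - T x)"
    using fun_cong[OF comp_power_limit[OF assms]] by (auto simp: null_space_def)
next
  fix y assume "y \<in> null_space (\<lambda>x. x - T x)"
  then have "P y = y"
    by (intro power_limit_fixed[OF assms(2)]) (simp add: null_space_def)
  then show "y \<in> range P" by (metis rangeI)
qed

text \<open>The vector \<open>P x\<close> is fixed by \<open>T\<close>, hence by
  \<open>P\<close>.\<close>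

lemma power_limit_idem:
  assumes "T \<in> bounded_ops smul" "ops_weakly_tendsto smul (\<lambda>n. T ^^ n) P"
  shows "P \<circ> P = P"
proof
  fix x
  show "(P \<circ> P) x = P x"
    using fun_cong[OF comp_power_limit[OF assms], of x]
    by (simp add: power_limit_fixed[OF assms(2)])
qed

lemma power_limit_comp_funpow:
  assumes "ops_weakly_tendsto smul (\<lambda>n. T ^^ n) P"
  shows "P \<circ> T ^^ k = P"
proof (induction k)
  case (Suc k)
  have "P \<circ> T ^^ Suc k = (P \<circ> T) \<circ> T ^^ k"
    by (simp add: comp_assoc)
  then show ?case
    by (simp only: power_limit_comp[OF assms] Suc.IH)
qed simp

lemma funpow_comp_power_limit:
  assumes "T \<in> bounded_ops smul" "ops_weakly_tendsto smul (\<lambda>n. T ^^ n) P"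
  shows "T ^^ n \<circ> P = P"
proof (induction n)
  case (Suc n)
  have "T ^^ Suc n \<circ> P = T \<circ> (T ^^ n \<circ> P)"
    by (simp add: comp_assoc)
  then show ?case
    by (simp only: comp_power_limit[OF assms] Suc.IH)
qed simp

text \<open>Both directions read off the identity of \<open>range P\<close> with the fixed vectors
  of \<open>T\<close>: the range is \<open>{0}\<close> exactly when \<open>P\<close>
  vanishes.\<close>

lemma power_weakly_null_iff:
  assumes T: "T \<in> bounded_ops smul"
  shows "ops_weakly_tendsto smul (\<lambda>n. T ^^ n) (\<lambda>x. 0) \<longleftrightarrow>
    (\<exists>P\<in>linear_ops smul. ops_weakly_tendsto smul (\<lambda>n. T ^^ n) P)
    \<and> null_space (\<lambda>x. x - T x) = {0}"
proof
  assume lim: "ops_weakly_tendsto smul (\<lambda>n. T ^^ n) (\<lambda>x. 0)"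
  moreover have "(\<lambda>x. 0) \<in> linear_ops smul"
    by (simp add: linear_ops_iff)
  moreover have "null_space (\<lambda>x. x - T x) = {0}"
    unfolding range_power_limit[OF T lim, symmetric] by auto
  ultimately show "(\<exists>P\<in>linear_ops smul. ops_weakly_tendsto smul (\<lambda>n. T ^^ n) P)
    \<and> null_space (\<lambda>x. x - T x) = {0}" by blast
next
  assume "(\<exists>P\<in>linear_ops smul. ops_weakly_tendsto smul (\<lambda>n. T ^^ n) P)
    \<and> null_space (\<lambda>x. x - T x) = {0}"
  then obtain P where lim: "ops_weakly_tendsto smul (\<lambda>n. T ^^ n) P"
    and null: "null_space (\<lambda>x. x - T x) = {0}"
    by blast
  have "P x = 0" for x
    using rangeI[of P x] unfolding range_power_limit[OF T lim] null by simp
  then have "P = (\<lambda>x. 0)" ..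
  then show "ops_weakly_tendsto smul (\<lambda>n. T ^^ n) (\<lambda>x. 0)"
    using lim by simp
qed

lemma not_eigenvalue_one_iff:
  assumes "T \<in> linear_ops smul"
  shows "\<not> is_eigenvalue smul T 1 \<longleftrightarrow> null_space (\<lambda>x. x - T x) = {0}"
proof -
  have fixed: "null_space (\<lambda>x. x - T x) = {x. T x = smul 1 x}"
    unfolding null_space_def right_minus_eq scale_one by (rule Collect_cong) (rule eq_commute)
  \<comment> \<open>This gives \<open>T 0 = 0\<close>, so that the set of fixed vectors contains 0
    and can equal \<open>{0}\<close>.\<close>
  have "T 0 + T 0 = T 0"
    using linear_ops_add[OF assms, of 0 0] by (simp only: add_0_left)
  then have "0 \<in> {x. T x = smul 1 x}"
    by simp
  then have "{x. T x = smul 1 x} = {0} \<longleftrightarrow> (\<forall>x. T x = smul 1 x \<longrightarrow> x = 0)"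
    by blast
  then show ?thesis
    unfolding is_eigenvalue_def fixed by blast
qed

end

theorem proposition2p6:
  fixes smul :: "'k::real_or_complex \<Rightarrow> 'v::real_normed_vector \<Rightarrow> 'v"
    and T :: "'v \<Rightarrow> 'v"
  assumes "normed_space_over smul"
    and "T \<in> linear_ops smul"
  shows
    "(ops_weakly_convergent smul (\<lambda>n. T ^^ n) \<longleftrightarrow>
        (\<exists>P\<in>linear_ops smul. ops_weakly_tendsto smul (\<lambda>n. T ^^ n) P))
     \<and> (T \<in> bounded_ops smul \<longrightarrow>
          (\<forall>P\<in>linear_ops smul. ops_weakly_tendsto smul (\<lambda>n. T ^^ n) P \<longrightarrow>
             (is_projection smul P \<and> range P = null_space (\<lambda>x. x - T x))
             \<and> (\<forall>n k. (T ^^ n) \<circ> P = P \<circ> (T ^^ k))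
             \<and> (\<forall>n\<ge>2. \<forall>k\<ge>2.
                  T \<circ> P = (T ^^ n) \<circ> P \<and> (T ^^ n) \<circ> P = P \<and> P = P ^^ 2 \<and>
                  P ^^ 2 = P \<circ> (T ^^ k) \<and> P \<circ> (T ^^ k) = P \<circ> T)))
     \<and> (T \<in> bounded_ops smul \<longrightarrow>
          (ops_weakly_tendsto smul (\<lambda>n. T ^^ n) (\<lambda>x. 0) \<longleftrightarrow>
             (\<exists>P\<in>linear_ops smul. ops_weakly_tendsto smul (\<lambda>n. T ^^ n) P)
             \<and> null_space (\<lambda>x. x - T x) = {0})
          \<and> (weakly_stable smul T \<longleftrightarrow>
               ops_weakly_convergent smul (\<lambda>n. T ^^ n) \<and> \<not> is_eigenvalue smul T 1))"
proof -
  interpret normed_space_over smul by (fact assms(1))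
  note conv = ops_weakly_convergent_iff[of "\<lambda>n. T ^^ n", OF linear_ops_funpow[OF assms(2)]]
  have bounded:
    "(is_projection smul P \<and> range P = null_space (\<lambda>x. x - T x))
      \<and> (\<forall>n k. (T ^^ n) \<circ> P = P \<circ> (T ^^ k))
      \<and> (\<forall>n\<ge>2. \<forall>k\<ge>2.
           T \<circ> P = (T ^^ n) \<circ> P \<and> (T ^^ n) \<circ> P = P \<and> P = P ^^ 2 \<and>
           P ^^ 2 = P \<circ> (T ^^ k) \<and> P \<circ> (T ^^ k) = P \<circ> T)"
    if T: "T \<in> bounded_ops smul" and P: "P \<in> linear_ops smul"
      and lim: "ops_weakly_tendsto smul (\<lambda>n. T ^^ n) P" for P
  proof -
    have sq: "P ^^ 2 = P"
      by (simp add: numeral_2_eq_2 power_limit_idem[OF T lim])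
    have "is_projection smul P"
      unfolding is_projection_def using P power_limit_idem[OF T lim] by (rule conjI)
    then show ?thesis
      \<comment> \<open>Every composition in the goal collapses to \<open>P\<close>, which turns the
        identities of (b) into instances of reflexivity.\<close>
      unfolding power_limit_comp[OF lim] comp_power_limit[OF T lim] sq
        power_limit_comp_funpow[OF lim] funpow_comp_power_limit[OF T lim]
      using range_power_limit[OF T lim] by (intro conjI allI impI refl)
  qed
  have stable: "weakly_stable smul T \<longleftrightarrow>
      ops_weakly_convergent smul (\<lambda>n. T ^^ n) \<and> \<not> is_eigenvalue smul T 1"
    if "T \<in> bounded_ops smul"
    unfolding weakly_stable_def power_weakly_null_iff[OF that] conv
      not_eigenvalue_one_iff[OF assms(2)] by (rule refl)
  show ?thesis
    by (intro conjI impI ballI conv bounded power_weakly_null_iff stable)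
qed

end
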